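(* Let $m\ge 2$ be an even integer and $n$ a positive integer with $n\equiv 0\pmod 4$. Then there exists a cyclic and $\phi_n$-symmetric hamiltonian cycle system of $K_{m\times n}$.
   Context: $K_{m\times n}$ is the complete multipartite graph with $m$ parts of size $n$, with vertex set identified with $\mathbb{Z}_{mn}$, parts the cosets of $m\mathbb{Z}_{mn}$, and $x,y$ adjacent iff $x-y\notin m\mathbb{Z}_{mn}$. A hamiltonian cycle system is a set of hamiltonian cycles whose edge sets partition the edge set; it is cyclic if it is closed under adding $1$ to all vertices of a cycle. $\phi_n$ is the map $x\mapsto x+m$ on $\mathbb{Z}_{mn}$; the system is $\phi_n$-symmetric if each of its cycles is mapped to itself by $\phi_n$. *)

theory Defs
  imports Main "HOL-Library.Disjoint_Sets"
begin

text \<open>The group of integers modulo \<open>N\<close> is represented by \<open>{0..<N}\<close> with arithmetic modulo \<open>N\<close>.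
  Undirected edges are two-element sets of vertices, and a cycle is identified with its edge set.\<close>

definition Zmod :: "int \<Rightarrow> int set" where
  "Zmod N = {0..<N}"

definition multiples_in_Zmod :: "int \<Rightarrow> int \<Rightarrow> int set" where
  "multiples_in_Zmod m N = (\<lambda>x. (m * x) mod N) ` Zmod N"

definition multipartite_verts :: "int \<Rightarrow> int \<Rightarrow> int set" where
  "multipartite_verts m n = Zmod (m * n)"

definition multipartite_edges :: "int \<Rightarrow> int \<Rightarrow> int set set" where
  "multipartite_edges m n =
     {{x, y} | x y. x \<in> multipartite_verts m n \<and> y \<in> multipartite_verts m n \<and>
        (x - y) mod (m * n) \<notin> multiples_in_Zmod m (m * n)}"

definition cycle_edges :: "'a list \<Rightarrow> 'a set set" where
  "cycle_edges vs = {{vs ! i, vs ! (Suc i mod length vs)} | i. i < length vs}"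

definition hamiltonian_cycle :: "'a set \<Rightarrow> 'a set set \<Rightarrow> 'a set set \<Rightarrow> bool" where
  "hamiltonian_cycle V E C \<longleftrightarrow>
     (\<exists>vs. 3 \<le> length vs \<and> distinct vs \<and> set vs = V \<and> cycle_edges vs \<subseteq> E \<and> C = cycle_edges vs)"

definition hamiltonian_cycle_system :: "'a set \<Rightarrow> 'a set set \<Rightarrow> 'a set set set \<Rightarrow> bool" where
  "hamiltonian_cycle_system V E H \<longleftrightarrow> (\<forall>C\<in>H. hamiltonian_cycle V E C) \<and> partition_on E H"

definition translation :: "int \<Rightarrow> int \<Rightarrow> int \<Rightarrow> int" where
  "translation N k x = (x + k) mod N"

definition map_cycle :: "('a \<Rightarrow> 'b) \<Rightarrow> 'a set set \<Rightarrow> 'b set set" where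
  "map_cycle f C = (\<lambda>e. f ` e) ` C"

definition cyclic_system :: "int \<Rightarrow> int set set set \<Rightarrow> bool" where
  "cyclic_system N H \<longleftrightarrow> (\<forall>C\<in>H. map_cycle (translation N 1) C \<in> H)"

definition phi :: "int \<Rightarrow> int \<Rightarrow> int \<Rightarrow> int" where
  "phi m n = translation (m * n) m"

definition phi_symmetric :: "int \<Rightarrow> int \<Rightarrow> int set set set \<Rightarrow> bool" where
  "phi_symmetric m n H \<longleftrightarrow> (\<forall>C\<in>H. map_cycle (phi m n) C = C)"

lemma diff_in_multiples_iff:
  assumes "0 < m" "0 < n"
  shows "(x - y) mod (m * n) \<in> multiples_in_Zmod m (m * n) \<longleftrightarrow> m dvd x - y"
proof
  assume "(x - y) mod (m * n) \<in> multiples_in_Zmod m (m * n)"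
  then obtain z where "(x - y) mod (m * n) = (m * z) mod (m * n)"
    by (auto simp: multiples_in_Zmod_def)
  then have "m dvd (x - y) mod (m * n)"
    by (simp add: dvd_mod)
  then show "m dvd x - y"
    by (simp add: dvd_mod_iff)
next
  assume "m dvd x - y"
  then obtain k where k: "x - y = m * k" ..
  have "(x - y) mod (m * n) = (m * (k mod (m * n))) mod (m * n)"
    by (simp add: k mod_mult_right_eq)
  moreover have "k mod (m * n) \<in> Zmod (m * n)"
    using assms by (simp add: Zmod_def)
  ultimately show "(x - y) mod (m * n) \<in> multiples_in_Zmod m (m * n)"
    by (auto simp: multiples_in_Zmod_def)
qed

end

theory Submission imports Defs begin

text \<open>A base cycle of type \<open>d\<close>, where \<open>d\<close> divides \<open>m\<close>, is a walk of \<open>d\<close> steps that meets every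
  residue modulo \<open>d\<close> once and whose total displacement generates \<open>d\<int>\<close> modulo \<open>mn\<close>. Continuing it
  periodically gives a hamiltonian cycle fixed by \<open>x \<mapsto> x + d\<close>, and its \<open>d\<close> translates contain
  each edge whose difference is, up to sign, one of the \<open>d\<close> steps. So it suffices to distribute the
  numbers in \<open>(0, mn/2)\<close> that are not multiples of \<open>m\<close> among the steps of base cycles.

  Write \<open>m = 2p\<close> and \<open>n = 4w\<close>. For \<open>j < 2w\<close> the even differences \<open>r + mj\<close> with \<open>r = 2, 4, \<dots>, m - 2\<close>,
  taken with alternating signs, form a zigzag path through all residues modulo \<open>m\<close> of one parity.
  For each \<open>i < w\<close> the zigzags \<open>j = 2i\<close> and \<open>j = 2i + 1\<close> are joined by two odd differences into a
  base cycle of type \<open>m\<close>; this uses up the even differences. The odd differences that remain are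
  grouped into pairs \<open>{q, q + 2}\<close>, and each pair is a base cycle of type \<open>2\<close>. The joining differences
  are chosen so that the total displacement is \<open>\<plusminus>m\<close>: they are \<open>4i + 1\<close> and \<open>4i + 3\<close>
  if \<open>p\<close> is odd, and \<open>2im + 1\<close> and \<open>2im + m - 1\<close> if \<open>p\<close> is even.\<close>

lemma int_div_less_iff:
  fixes x k w :: int
  assumes "0 < k"
  shows "x div k < w \<longleftrightarrow> x < k * w"
proof
  assume "x div k < w"
  then have "k * (x div k + 1) \<le> k * w" using assms by simp
  moreover have "x < k * (x div k + 1)"
    using pos_mod_bound[OF assms, of x] mult_div_mod_eq[of k x] by (simp only: distrib_left)
  ultimately show "x < k * w" by linarith
next
  assume "x < k * w"
  moreover have "k * (x div k) \<le> x"
    using pos_mod_sign[OF assms, of x] mult_div_mod_eq[of k x] by linarith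
  ultimately have "k * (x div k) < k * w" by linarith
  then show "x div k < w" using assms by simp
qed

section \<open>Hamiltonian cycles developed from a base walk\<close>

text \<open>Since \<open>k\<close> runs over all integers, invariance under translation by
  \<open>d\<close> is built in. That these edges form one closed cycle is a separate matter and
  depends on the total displacement of \<open>a\<close>.\<close>

definition dev_cycle :: "int \<Rightarrow> nat \<Rightarrow> (nat \<Rightarrow> int) \<Rightarrow> int set set" where
  "dev_cycle N d a =
     {{(a r + int d * k) mod N, (a (Suc r) + int d * k) mod N} | r k. r < d}"

lemma edge_in_multipartite_edges:
  assumes "0 < m" "0 < n" "\<not> m dvd x - y"
  shows "{x mod (m * n), y mod (m * n)} \<in> multipartite_edges m n"
proof -
  have "(x mod (m * n) - y mod (m * n)) mod (m * n) = (x - y) mod (m * n)"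
    by (simp add: mod_diff_eq)
  then have "(x mod (m * n) - y mod (m * n)) mod (m * n) \<notin> multiples_in_Zmod m (m * n)"
    using diff_in_multiples_iff[OF assms(1,2), of x y] assms(3) by simp
  moreover have "x mod (m * n) \<in> multipartite_verts m n" "y mod (m * n) \<in> multipartite_verts m n"
    using assms by (auto simp: multipartite_verts_def Zmod_def)
  ultimately show ?thesis
    unfolding multipartite_edges_def by blast
qed

lemma multipartite_edgesE:
  assumes "0 < m" "0 < n" "e \<in> multipartite_edges m n"
  obtains x y where "e = {x mod (m * n), y mod (m * n)}" "\<not> m dvd x - y"
proof -
  obtain x y where "e = {x, y}" "x \<in> {0..<m * n}" "y \<in> {0..<m * n}"
      "(x - y) mod (m * n) \<notin> multiples_in_Zmod m (m * n)"
    using assms(3) by (auto simp: multipartite_edges_def multipartite_verts_def Zmod_def)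
  then have "e = {x mod (m * n), y mod (m * n)}" "\<not> m dvd x - y"
    using diff_in_multiples_iff[OF assms(1,2), of x y] by auto
  then show thesis by (rule that)
qed

text \<open>The walk \<open>b\<close> repeats the \<open>d\<close> steps of \<open>a\<close>, each
  round displaced by \<open>s\<close> from the previous one. A vertex reveals its position within
  the round by its residue modulo \<open>d\<close>, and then its round, because \<open>s / d\<close>
  is a unit modulo \<open>N / d\<close>. So the first \<open>N\<close> vertices are distinct. For
  the same reason the multiples of \<open>s\<close> and of \<open>d\<close> agree modulo
  \<open>N\<close>, which makes the edges of the walk those of \<open>dev_cycle\<close>.\<close>

lemma hamiltonian_cycle_dev_cycle:
  fixes m n :: int and d :: nat
  assumes "0 < m" "0 < n" "3 \<le> m * n" "0 < d" "int d dvd m"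
    and inj: "inj_on (\<lambda>r. a r mod int d) {..<d}"
    and gcd: "gcd (a d - a 0) (m * n) = int d"
    and steps: "\<And>r. r < d \<Longrightarrow> \<not> m dvd a (Suc r) - a r"
  shows "hamiltonian_cycle (multipartite_verts m n) (multipartite_edges m n) (dev_cycle (m * n) d a)"
proof -
  define N where "N = m * n"
  define s where "s = a d - a 0"
  have "N > 0" using assms by (simp add: N_def)
  obtain N' where N': "N = int d * N'"
    using gcd unfolding N_def by (metis dvd_def gcd_dvd2)
  obtain s' where s': "s = int d * s'"
    using gcd unfolding s_def by (metis dvd_def gcd_dvd1)
  have "int d * gcd s' N' = int d"
    using gcd gcd_mult_distrib_int[of "int d" s' N'] N' s'
    by (simp add: s_def[symmetric] N_def[symmetric])
  then have cop: "coprime s' N'"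
    using \<open>0 < d\<close> by (simp add: coprime_iff_gcd_eq_1)
  have "N' > 0" using N' \<open>N > 0\<close> \<open>0 < d\<close> by (simp add: zero_less_mult_iff)
  define b where "b i = a (i mod d) + int (i div d) * s" for i
  have b_Suc: "b (Suc i) = a (Suc (i mod d)) + int (i div d) * s" for i
  proof (cases "Suc (i mod d) = d")
    case True
    then have "Suc i mod d = 0" "Suc i div d = Suc (i div d)"
      by (simp_all add: mod_Suc div_Suc)
    then show ?thesis using True by (simp add: b_def s_def algebra_simps)
  next
    case False
    then have "Suc i mod d = Suc (i mod d)" "Suc i div d = i div d"
      by (simp_all add: mod_Suc div_Suc)
    then show ?thesis by (simp add: b_def)
  qed
  have b_inj: "i = j" if "i < nat N" "j < nat N" "b i mod N = b j mod N" for i j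
  proof -
    have bd: "b i mod int d = a (i mod d) mod int d" for i
      by (simp add: b_def s' mod_add_right_eq[symmetric])
    have "b i mod int d = b j mod int d"
      using that(3) N' by (metis mod_mult_eq mod_mod_cancel dvd_triv_left)
    then have im: "i mod d = j mod d"
      using inj \<open>0 < d\<close> by (auto simp: bd inj_on_def)
    have "N dvd b i - b j" using that(3) by (simp add: mod_eq_dvd_iff)
    then have "int d * N' dvd int d * ((int (i div d) - int (j div d)) * s')"
      by (simp add: b_def im N' s' algebra_simps)
    then have "N' dvd (int (i div d) - int (j div d)) * s'"
      using \<open>0 < d\<close> by (simp only: dvd_mult_cancel_left) simp
    then have "N' dvd int (i div d) - int (j div d)"
      using cop by (simp add: coprime_dvd_mult_left_iff coprime_commute)
    moreover have "int (k div d) < N'" if "k < nat N" for k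
    proof -
      have "k < nat N' * d" using that N' \<open>0 < d\<close> \<open>N' > 0\<close>
        by (metis mult.commute nat_int nat_mult_distrib of_nat_0_le_iff)
      then have "k div d < nat N'" by (simp add: less_mult_imp_div_less)
      then show ?thesis by linarith
    qed
    ultimately have "int (i div d) = int (j div d)"
      using that by (smt (verit) zdvd_not_zless of_nat_0_le_iff dvd_minus_iff)
    then show ?thesis using im by (metis div_mult_mod_eq of_nat_eq_iff)
  qed
  define vs where "vs = map (\<lambda>i. b i mod N) [0..<nat N]"
  have len: "length vs = nat N" by (simp add: vs_def)
  have dist: "distinct vs"
    unfolding vs_def by (auto simp: distinct_map inj_on_def intro: b_inj)
  have set: "set vs = multipartite_verts m n"
  proof (rule card_subset_eq)
    show "card (set vs) = card (multipartite_verts m n)"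
      using distinct_card[OF dist] len by (simp add: multipartite_verts_def Zmod_def N_def)
  qed (use \<open>N > 0\<close> in \<open>auto simp: vs_def multipartite_verts_def Zmod_def N_def\<close>)
  \<comment> \<open>After \<open>N'\<close> rounds the displacement is
    \<open>N' * s = N * s'\<close>, so the walk closes up modulo \<open>N\<close>.\<close>
  have bN: "b (nat N) = a 0 + N * s'"
  proof -
    have "nat N = nat N' * d" using N' \<open>N' > 0\<close> by (simp add: nat_mult_distrib)
    then have "nat N mod d = 0" "nat N div d = nat N'" using \<open>0 < d\<close> by simp_all
    then show ?thesis using \<open>N' > 0\<close> by (simp add: b_def N' s')
  qed
  have nth: "vs ! i = b i mod N" "vs ! (Suc i mod length vs) = b (Suc i) mod N" if "i < nat N" for i
  proof -
    show "vs ! i = b i mod N" using that by (simp add: vs_def)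
    show "vs ! (Suc i mod length vs) = b (Suc i) mod N"
    proof (cases "Suc i = nat N")
      case True
      then have "vs ! (Suc i mod length vs) = b 0 mod N" using \<open>N > 0\<close> by (simp add: vs_def)
      then show ?thesis using True bN by (simp add: b_def)
    next
      case False
      then show ?thesis using that by (simp add: vs_def)
    qed
  qed
  have "cycle_edges vs = {{b i mod N, b (Suc i) mod N} | i. i < nat N}"
    unfolding cycle_edges_def using nth len by (metis (no_types, lifting))
  also have "\<dots> = dev_cycle N d a"
  proof (intro equalityI subsetI)
    fix e assume "e \<in> {{b i mod N, b (Suc i) mod N} | i. i < nat N}"
    then obtain i where e: "e = {b i mod N, b (Suc i) mod N}" by blast
    have "e = {(a (i mod d) + int d * (int (i div d) * s')) mod N,
               (a (Suc (i mod d)) + int d * (int (i div d) * s')) mod N}"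
      unfolding e b_Suc by (simp add: b_def s' mult.left_commute)
    moreover have "i mod d < d" using \<open>0 < d\<close> by simp
    ultimately show "e \<in> dev_cycle N d a" unfolding dev_cycle_def by blast
  next
    fix e assume "e \<in> dev_cycle N d a"
    then obtain r k where r: "r < d"
      and e: "e = {(a r + int d * k) mod N, (a (Suc r) + int d * k) mod N}"
      unfolding dev_cycle_def by blast
    \<comment> \<open>A Bezout inverse \<open>u\<close> of \<open>s'\<close> modulo
      \<open>N'\<close> gives the number \<open>t\<close> of rounds whose displacement
      \<open>t * s\<close> equals \<open>d * k\<close> modulo \<open>N\<close>. Its reduction
      \<open>q\<close> modulo \<open>N'\<close> keeps the index \<open>q * d + r\<close> below
      \<open>N\<close>.\<close>
    obtain t where t: "N' dvd s' * t - k"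
    proof -
      obtain u v where "u * s' + v * N' = 1"
        using cop bezout_int[of s' N'] by (auto simp: coprime_iff_gcd_eq_1)
      then have "k = k * (u * s' + v * N')" by simp
      then have "s' * (u * k) - k = N' * (- (v * k))" by (simp add: algebra_simps)
      then show thesis using that[of "u * k"] by (metis dvd_triv_left)
    qed
    define q where "q = nat (t mod N')"
    have q: "int q = t mod N'" "int q < N'" using \<open>N' > 0\<close> by (simp_all add: q_def)
    have "N' dvd s' * int q - k"
    proof -
      have "(s' * int q - k) mod N' = (s' * t - k) mod N'"
        unfolding q by (metis mod_diff_left_eq mod_mult_right_eq)
      then show ?thesis using t by (simp add: dvd_eq_mod_eq_0)
    qed
    then have Nd: "N dvd int q * s - int d * k"
      unfolding N' s' by (metis mult_dvd_mono dvd_refl right_diff_distrib' mult.left_commute mult.commute)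
    define i where "i = q * d + r"
    have i: "i mod d = r" "i div d = q" using r by (simp_all add: i_def)
    have "int i < N"
    proof -
      have "int q * int d + int d \<le> N' * int d"
        using q(2) by (metis add.commute distrib_right mult.left_neutral mult_right_mono
            of_nat_0_le_iff zless_imp_add1_zle)
      then show ?thesis using r by (simp add: i_def N' mult.commute)
    qed
    moreover have "(c + int d * k) mod N = (c + int q * s) mod N" for c
      using Nd by (metis mod_add_right_eq mod_eq_dvd_iff)
    then have "e = {b i mod N, b (Suc i) mod N}"
      unfolding e b_Suc b_def[of i] i by simp
    ultimately show "e \<in> {{b i mod N, b (Suc i) mod N} | i. i < nat N}" by auto
  qed
  finally have ce: "cycle_edges vs = dev_cycle N d a" .
  have "dev_cycle N d a \<subseteq> multipartite_edges m n"
  proof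
    fix e assume "e \<in> dev_cycle N d a"
    then obtain r k where r: "r < d"
      and e: "e = {(a (Suc r) + int d * k) mod N, (a r + int d * k) mod N}"
      unfolding dev_cycle_def by (auto simp: insert_commute)
    show "e \<in> multipartite_edges m n"
      unfolding e N_def using assms steps[OF r] by (intro edge_in_multipartite_edges) auto
  qed
  then show ?thesis
    unfolding hamiltonian_cycle_def using len dist set ce \<open>3 \<le> m * n\<close> unfolding N_def
    by (intro exI[of _ vs]) auto
qed

lemma map_cycle_translation_dev_cycle:
  "map_cycle (translation N s) (dev_cycle N d a) = dev_cycle N d (\<lambda>r. a r + s)"
proof -
  have *: "translation N s ` {(a r + int d * k) mod N, (a (Suc r) + int d * k) mod N}
      = {(a r + s + int d * k) mod N, (a (Suc r) + s + int d * k) mod N}" for r k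
    by (simp add: translation_def mod_simps ac_simps)
  have "map_cycle (translation N s) (dev_cycle N d a) =
      {translation N s ` {(a r + int d * k) mod N, (a (Suc r) + int d * k) mod N} | r k. r < d}"
    unfolding map_cycle_def dev_cycle_def by blast
  then show ?thesis unfolding * dev_cycle_def .
qed

lemma dev_cycle_shift:
  assumes "int d dvd s"
  shows "dev_cycle N d (\<lambda>r. a r + s) = dev_cycle N d a"
proof -
  \<comment> \<open>One inclusion suffices: the reverse one is the same fact for the shifted
    sequence and \<open>- k\<close>.\<close>
  have *: "dev_cycle N d (\<lambda>r. a r + int d * k) \<subseteq> dev_cycle N d a" for k a
  proof
    fix e assume "e \<in> dev_cycle N d (\<lambda>r. a r + int d * k)"
    then obtain r l where "r < d" "e = {(a r + int d * k + int d * l) mod N,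
        (a (Suc r) + int d * k + int d * l) mod N}"
      unfolding dev_cycle_def by blast
    then have "r < d" "e = {(a r + int d * (k + l)) mod N, (a (Suc r) + int d * (k + l)) mod N}"
      by (simp_all add: distrib_left add.assoc)
    then show "e \<in> dev_cycle N d a" unfolding dev_cycle_def by blast
  qed
  obtain k where k: "s = int d * k" using assms ..
  from *[of "\<lambda>r. a r + s" "- k"] *[of a k] show ?thesis by (auto simp: k)
qed

section \<open>Base cycles whose steps exhaust the differences\<close>

text \<open>An edge determines its difference up to sign modulo \<open>N\<close>, and numbers below
  \<open>N / 2\<close> in absolute value are congruent modulo \<open>N\<close> only if equal. For
  equal nonzero differences a match with the endpoints swapped would make \<open>N\<close> divide
  \<open>2 * \<delta>\<close>, so the starting points agree.\<close>

lemma pair_mod_eqD: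
  fixes N :: int
  assumes "{x mod N, (x + \<delta>) mod N} = {y mod N, (y + \<epsilon>) mod N}"
    and "2 * \<bar>\<delta>\<bar> < N" "2 * \<bar>\<epsilon>\<bar> < N"
  shows "\<bar>\<delta>\<bar> = \<bar>\<epsilon>\<bar>" and "\<delta> = \<epsilon> \<Longrightarrow> \<delta> \<noteq> 0 \<Longrightarrow> N dvd x - y"
proof -
  have "N dvd x - y \<and> N dvd (x + \<delta>) - (y + \<epsilon>) \<or> N dvd x - (y + \<epsilon>) \<and> N dvd (x + \<delta>) - y"
    using assms(1) by (auto simp: doubleton_eq_iff mod_eq_dvd_iff)
  then have "N dvd x - y \<and> N dvd \<delta> - \<epsilon> \<or> N dvd \<delta> + \<epsilon>"
  proof (elim disjE conjE)
    assume "N dvd x - y" "N dvd (x + \<delta>) - (y + \<epsilon>)"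
    then show ?thesis using dvd_diff[of N "(x + \<delta>) - (y + \<epsilon>)" "x - y"] by (simp add: algebra_simps)
  next
    assume "N dvd x - (y + \<epsilon>)" "N dvd (x + \<delta>) - y"
    then show ?thesis using dvd_diff[of N "(x + \<delta>) - y" "x - (y + \<epsilon>)"] by (simp add: algebra_simps)
  qed
  moreover have "\<delta> - \<epsilon> = 0" if "N dvd \<delta> - \<epsilon>"
    using that assms(2,3) dvd_imp_le_int[of "\<delta> - \<epsilon>" N] by linarith
  moreover have "\<delta> + \<epsilon> = 0" if "N dvd \<delta> + \<epsilon>"
    using that assms(2,3) dvd_imp_le_int[of "\<delta> + \<epsilon>" N] by linarith
  ultimately show "\<bar>\<delta>\<bar> = \<bar>\<epsilon>\<bar>" and "\<delta> = \<epsilon> \<Longrightarrow> \<delta> \<noteq> 0 \<Longrightarrow> N dvd x - y"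
    by auto
qed

text \<open>The difference of an edge, reduced up to sign to \<open>(0, mn/2)\<close>, occurs as
  exactly one step \<open>r\<close> of exactly one base cycle \<open>b\<close> by
  \<open>bij\<close>. The starting point of the edge then fixes the translate of that cycle up to a
  multiple of \<open>d b\<close>, so every edge lies in exactly one translate.\<close>

lemma base_cycles_imp_hamiltonian_cycle_system:
  fixes m n :: int and a :: "'b \<Rightarrow> nat \<Rightarrow> int" and d :: "'b \<Rightarrow> nat"
  assumes "0 < m" "0 < n" "even n" "3 \<le> m * n"
    and d: "\<And>b. b \<in> B \<Longrightarrow> 0 < d b" "\<And>b. b \<in> B \<Longrightarrow> int (d b) dvd m"
    and inj: "\<And>b. b \<in> B \<Longrightarrow> inj_on (\<lambda>r. a b r mod int (d b)) {..<d b}"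
    and gcd: "\<And>b. b \<in> B \<Longrightarrow> gcd (a b (d b) - a b 0) (m * n) = int (d b)"
    and bij: "bij_betw (\<lambda>(b, r). \<bar>a b (Suc r) - a b r\<bar>) (SIGMA b:B. {..<d b})
                {x. 0 < x \<and> 2 * x < m * n \<and> \<not> m dvd x}"
  shows "\<exists>H. hamiltonian_cycle_system (multipartite_verts m n) (multipartite_edges m n) H \<and>
             cyclic_system (m * n) H \<and> phi_symmetric m n H"
proof -
  define N where "N = m * n"
  define C where "C b t = dev_cycle N (d b) (\<lambda>r. a b r + t)" for b t
  \<comment> \<open>All integers \<open>t\<close> are allowed as shifts, which makes closure under
    translation immediate; coinciding translates are identified by \<open>C_cong\<close>.\<close>
  define H where "H = {C b t | b t. b \<in> B}"
  have step: "0 < \<bar>a b (Suc r) - a b r\<bar>" "2 * \<bar>a b (Suc r) - a b r\<bar> < N" "\<not> m dvd a b (Suc r) - a b r"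
    if "b \<in> B" "r < d b" for b r
    using bij_betwE[OF bij] that by (auto simp: N_def)
  have C_trans: "map_cycle (translation N s) (C b t) = C b (t + s)" for s b t
    unfolding C_def map_cycle_translation_dev_cycle by (simp add: add.assoc)
  have C_cong: "C b t = C b t'" if "int (d b) dvd t - t'" for b t t'
    using dev_cycle_shift[OF that, of N "\<lambda>r. a b r + t'"] by (simp add: C_def)
  have ham: "hamiltonian_cycle (multipartite_verts m n) (multipartite_edges m n) (C b t)"
    if "b \<in> B" for b t
    unfolding C_def N_def
  proof (rule hamiltonian_cycle_dev_cycle)
    show "inj_on (\<lambda>r. (a b r + t) mod int (d b)) {..<d b}"
      using inj[OF that] unfolding inj_on_def by (simp add: mod_eq_dvd_iff)
  qed (use assms that step in auto)
  \<comment> \<open>The shift \<open>x - a b r\<close> moves the start of step \<open>r\<close> to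
    \<open>x\<close>.\<close>
  have C_I: "{x mod N, (x + (a b (Suc r) - a b r)) mod N} \<in> C b (x - a b r)" if "r < d b" for b r x
    unfolding C_def dev_cycle_def using that
    by (intro CollectI exI[of _ r] exI[of _ 0]) (simp add: algebra_simps)
  have Union: "\<Union> H = multipartite_edges m n"
  proof (intro equalityI subsetI)
    fix e assume "e \<in> \<Union> H"
    then show "e \<in> multipartite_edges m n"
      using ham unfolding H_def hamiltonian_cycle_def by blast
  next
    fix e assume "e \<in> multipartite_edges m n"
    then obtain x y where e: "e = {x mod N, y mod N}" "\<not> m dvd x - y"
      using assms multipartite_edgesE unfolding N_def by metis
    define z where "z = (y - x) mod N"
    have "N > 0" using assms by (simp add: N_def)
    have mz: "\<not> m dvd z"
      using e(2) unfolding z_def N_def by (simp add: dvd_mod_iff dvd_diff_commute)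
    \<comment> \<open>Here evenness of \<open>n\<close> enters: \<open>N / 2\<close> is a multiple
      of \<open>m\<close>, so it is not the difference of an edge.\<close>
    have "2 * z \<noteq> N"
    proof
      assume "2 * z = N"
      then have "z = m * (n div 2)" using \<open>even n\<close> by (auto simp: N_def)
      with mz show False by simp
    qed
    have "0 \<le> z" "z < N" using \<open>N > 0\<close> by (simp_all add: z_def)
    define w where "w = (if 2 * z < N then z else N - z)"
    have "w \<in> {x. 0 < x \<and> 2 * x < m * n \<and> \<not> m dvd x}"
      using mz \<open>2 * z \<noteq> N\<close> \<open>0 \<le> z\<close> \<open>z < N\<close>
      by (auto simp: w_def N_def dvd_diff_right_iff intro: le_neq_trans)
    then have "w \<in> (\<lambda>(b, r). \<bar>a b (Suc r) - a b r\<bar>) ` (SIGMA b:B. {..<d b})"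
      by (simp only: bij_betw_imp_surj_on[OF bij])
    then obtain b r where br: "b \<in> B" "r < d b" "w = \<bar>a b (Suc r) - a b r\<bar>"
      by (elim imageE SigmaE) simp
    define \<delta> where "\<delta> = a b (Suc r) - a b r"
    have "N dvd y - x - z" unfolding z_def by (rule dvd_minus_mod)
    \<comment> \<open>The step is \<open>z\<close> or \<open>- z\<close> modulo \<open>N\<close>;
      the sign decides whether it traverses the edge from \<open>x\<close> or from
      \<open>y\<close>.\<close>
    then have "N dvd y - x - \<delta> \<or> N dvd y - x + \<delta>"
    proof -
      have "\<delta> = z \<or> \<delta> = -z \<or> \<delta> = N - z \<or> \<delta> = z - N"
        using br(3) by (auto simp: w_def \<delta>_def split: if_splits)
      moreover have "N dvd y - x - z + N" "N dvd y - x - z - N"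
        using \<open>N dvd y - x - z\<close> by simp_all
      ultimately show ?thesis using \<open>N dvd y - x - z\<close> by (auto simp: algebra_simps)
    qed
    then have "e = {x mod N, (x + \<delta>) mod N} \<or> e = {y mod N, (y + \<delta>) mod N}"
    proof
      assume "N dvd y - x - \<delta>"
      then have "y mod N = (x + \<delta>) mod N" by (simp add: mod_eq_dvd_iff algebra_simps)
      then show ?thesis using e by simp
    next
      assume "N dvd y - x + \<delta>"
      then have "(y + \<delta>) mod N = x mod N" by (simp add: mod_eq_dvd_iff algebra_simps)
      then show ?thesis using e by (simp add: insert_commute)
    qed
    then show "e \<in> \<Union> H" using C_I[OF br(2)] br(1) unfolding H_def \<delta>_def by blast
  qed
  have disj: "C b t = C b' t'" 
    if "b \<in> B" "b' \<in> B" and eC: "e \<in> C b t" "e \<in> C b' t'" for b t b' t' e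
  proof -
    obtain r k where r: "r < d b" and e: "e = {(a b r + t + int (d b) * k) mod N,
        (a b (Suc r) + t + int (d b) * k) mod N}"
      using eC(1) unfolding C_def dev_cycle_def by blast
    obtain r' k' where r': "r' < d b'" and e': "e = {(a b' r' + t' + int (d b') * k') mod N,
        (a b' (Suc r') + t' + int (d b') * k') mod N}"
      using eC(2) unfolding C_def dev_cycle_def by blast
    define x where "x = a b r + t + int (d b) * k"
    define x' where "x' = a b' r' + t' + int (d b') * k'"
    define \<delta> where "\<delta> = a b (Suc r) - a b r"
    define \<delta>' where "\<delta>' = a b' (Suc r') - a b' r'"
    have "{x mod N, (x + \<delta>) mod N} = {x' mod N, (x' + \<delta>') mod N}"
      using e e' by (simp add: x_def x'_def \<delta>_def \<delta>'_def algebra_simps)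
    note eqD = pair_mod_eqD[OF this step(2)[OF that(1) r, folded \<delta>_def]
        step(2)[OF that(2) r', folded \<delta>'_def]]
    have "(b, r) = (b', r')"
      using inj_onD[OF bij_betw_imp_inj_on[OF bij], of "(b, r)" "(b', r')"] eqD(1) that r r'
      by (simp add: \<delta>_def \<delta>'_def)
    then have bb: "b = b'" "r = r'" by simp_all
    then have "N dvd x - x'"
      using eqD(2) step(1)[OF that(1) r] by (simp add: \<delta>_def \<delta>'_def)
    moreover have "int (d b) dvd N" using d(2)[OF that(1)] by (simp add: N_def)
    \<comment> \<open>Congruence modulo \<open>N\<close> is weakened to congruence modulo
      \<open>d b\<close>, where the developing shifts \<open>k\<close> and \<open>k'\<close>
      vanish.\<close>
    ultimately have "int (d b) dvd (x - x') - int (d b) * (k - k')"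
      by (meson dvd_diff dvd_trans dvd_triv_left)
    then have "int (d b) dvd t - t'"
      by (simp add: x_def x'_def bb algebra_simps)
    then show ?thesis using C_cong bb by simp
  qed
  have ne: "C b t \<noteq> {}" if "b \<in> B" for b t
    unfolding C_def dev_cycle_def using d(1)[OF that] by blast
  have "partition_on (multipartite_edges m n) H"
  proof (rule partition_onI)
    show "\<Union> H = multipartite_edges m n" by (rule Union)
  next
    fix p q assume "p \<in> H" "q \<in> H" "p \<noteq> q"
    then show "disjnt p q" using disj unfolding H_def disjnt_def by blast
  next
    show "{} \<notin> H" using ne by (auto simp: H_def)
  qed
  moreover have "\<forall>C\<in>H. hamiltonian_cycle (multipartite_verts m n) (multipartite_edges m n) C"
    using ham by (auto simp: H_def)
  moreover have "cyclic_system (m * n) H"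
    using C_trans unfolding cyclic_system_def H_def N_def by blast
  moreover have "phi_symmetric m n H"
  proof -
    have "C b (t + m) = C b t" if "b \<in> B" for b t
      using d(2)[OF that] by (intro C_cong) simp
    then show ?thesis
      unfolding phi_symmetric_def phi_def H_def N_def[symmetric] using C_trans by auto
  qed
  ultimately show ?thesis unfolding hamiltonian_cycle_system_def by blast
qed

section \<open>Zigzag paths and their joining in pairs\<close>

text \<open>The partial sums of \<open>2 + mj, -(4 + mj), 6 + mj, \<dots>\<close>\<close>

definition zigzag :: "int \<Rightarrow> int \<Rightarrow> nat \<Rightarrow> int" where
  "zigzag m j r = (if even r then - int r else int r + 1 + m * j)"

lemma abs_zigzag_step:
  assumes "0 \<le> m" "0 \<le> j"
  shows "\<bar>zigzag m j (Suc r) - zigzag m j r\<bar> = 2 * (int r + 1) + m * j"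
  using mult_nonneg_nonneg[OF assms] by (auto simp: zigzag_def)

lemma even_zigzag: "even m \<Longrightarrow> even (zigzag m j r)"
  by (auto simp: zigzag_def)

text \<open>Modulo \<open>m\<close> the vertices are \<open>0, 2, -2, 4, -4, ...\<close>. Up to
  sign, two of them differ by \<open>r - s\<close> if the indices have equal parity and by
  \<open>r + s + 1\<close> otherwise. For distinct indices below \<open>p\<close> both numbers are
  nonzero and smaller than \<open>2 * p\<close> in absolute value.\<close>

lemma zigzag_inj_mod:
  assumes "r < p" "s < p" "m = 2 * int p" "m dvd zigzag m j r - zigzag m j s"
  shows "r = s"
proof -
  have *: "m dvd int r - int s \<or> m dvd int r + int s + 1"
  proof -
    consider "even r" "even s" | "odd r" "odd s" | "even r" "odd s" | "odd r" "even s" by blast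
    then show ?thesis
    proof cases
      case 1
      then have "m dvd - (int r - int s)" using assms(4) by (simp add: zigzag_def)
      then show ?thesis by (simp only: dvd_minus_iff) simp
    next
      case 2
      then show ?thesis using assms(4) by (simp add: zigzag_def)
    next
      case 3
      then have "zigzag m j r - zigzag m j s = - (int r + int s + 1) - m * j" by (simp add: zigzag_def)
      then have "m dvd - (int r + int s + 1) - m * j" using assms(4) by (simp only:)
      then have "m dvd - (int r + int s + 1)" by (simp only: dvd_diff_left_iff dvd_triv_left)
      then show ?thesis by (simp only: dvd_minus_iff) simp
    next
      case 4
      then have "zigzag m j r - zigzag m j s = (int r + int s + 1) + m * j" by (simp add: zigzag_def)
      then have "m dvd (int r + int s + 1) + m * j" using assms(4) by (simp only:)
      then show ?thesis by (simp only: dvd_add_left_iff dvd_triv_left) simp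
    qed
  qed
  show ?thesis
  proof (rule ccontr)
    assume "r \<noteq> s"
    with * show False
      using assms(1-3) dvd_imp_le_int[of "int r - int s" m] dvd_imp_le_int[of "int r + int s + 1" m]
      by linarith
  qed
qed

text \<open>Every zigzag starts at 0, so \<open>c\<close> is the step from the end of the first
  zigzag to the start \<open>e\<close> of the second. The last branch matters only at
  \<open>r = 2 * p\<close>: there it is the endpoint of the closing step \<open>c'\<close>, hence
  the total displacement.\<close>

definition double_zigzag :: "nat \<Rightarrow> int \<Rightarrow> int \<Rightarrow> int \<Rightarrow> int \<Rightarrow> nat \<Rightarrow> int" where
  "double_zigzag p j c k c' r =
     (let m = 2 * int p; e = zigzag m j (p - 1) + c in
      if r < p then zigzag m j r
      else if r < 2 * p then e + zigzag m k (r - p)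
      else e + zigzag m k (p - 1) + c')"

text \<open>With \<open>c\<close> odd the first \<open>p\<close> vertices are even and the next
  \<open>p\<close> odd. As the modulus is even, a coincidence stays within one half, where the
  single zigzag is injective.\<close>

lemma double_zigzag_inj_mod:
  assumes "odd c"
  shows "inj_on (\<lambda>r. double_zigzag p j c k c' r mod int (2 * p)) {..<2 * p}"
proof (rule inj_onI)
  fix r s
  assume rs: "r \<in> {..<2 * p}" "s \<in> {..<2 * p}"
    and eq: "double_zigzag p j c k c' r mod int (2 * p) = double_zigzag p j c k c' s mod int (2 * p)"
  define m where "m = 2 * int p"
  have m: "int (2 * p) = m" by (simp add: m_def)
  have dvd: "m dvd double_zigzag p j c k c' r - double_zigzag p j c k c' s"
    using eq unfolding m by (simp add: mod_eq_dvd_iff)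
  have "even m" by (simp add: m_def)
  have "even (double_zigzag p j c k c' r - double_zigzag p j c k c' s)"
    using dvd \<open>even m\<close> dvd_trans by blast
  moreover have "even (double_zigzag p j c k c' t) \<longleftrightarrow> t < p" if "t < 2 * p" for t
    using that assms even_zigzag[OF \<open>even m\<close>] by (simp add: double_zigzag_def Let_def flip: m_def)
  ultimately have "r < p \<longleftrightarrow> s < p" using rs by simp
  then consider "r < p" "s < p" | "\<not> r < p" "\<not> s < p" by blast
  then show "r = s"
  proof cases
    case 1
    then show ?thesis using dvd zigzag_inj_mod[of r p s m j]
      by (simp add: double_zigzag_def Let_def flip: m_def)
  next
    case 2
    then have "m dvd zigzag m k (r - p) - zigzag m k (s - p)"
      using dvd rs by (simp add: double_zigzag_def Let_def flip: m_def)
    then have "r - p = s - p"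
      using 2 rs by (intro zigzag_inj_mod[of _ p _ m k]) (auto simp: m_def)
    then show ?thesis using 2 by simp
  qed
qed

lemma abs_double_zigzag_step:
  assumes "0 \<le> j" "0 \<le> k"
  shows "Suc r < p \<Longrightarrow>
      \<bar>double_zigzag p j c k c' (Suc r) - double_zigzag p j c k c' r\<bar> = 2 * (int r + 1) + 2 * int p * j"
    and "Suc r = p \<Longrightarrow> \<bar>double_zigzag p j c k c' (Suc r) - double_zigzag p j c k c' r\<bar> = \<bar>c\<bar>"
    and "Suc r < p \<Longrightarrow> \<bar>double_zigzag p j c k c' (Suc (p + r)) - double_zigzag p j c k c' (p + r)\<bar>
      = 2 * (int r + 1) + 2 * int p * k"
    and "Suc r = 2 * p \<Longrightarrow> \<bar>double_zigzag p j c k c' (Suc r) - double_zigzag p j c k c' r\<bar> = \<bar>c'\<bar>"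
proof -
  show "Suc r < p \<Longrightarrow>
      \<bar>double_zigzag p j c k c' (Suc r) - double_zigzag p j c k c' r\<bar> = 2 * (int r + 1) + 2 * int p * j"
    using abs_zigzag_step[of "2 * int p" j r] assms by (simp add: double_zigzag_def Let_def)
  show "Suc r = p \<Longrightarrow> \<bar>double_zigzag p j c k c' (Suc r) - double_zigzag p j c k c' r\<bar> = \<bar>c\<bar>"
    by (auto simp: double_zigzag_def zigzag_def Let_def)
  show "Suc r < p \<Longrightarrow> \<bar>double_zigzag p j c k c' (Suc (p + r)) - double_zigzag p j c k c' (p + r)\<bar>
      = 2 * (int r + 1) + 2 * int p * k"
    using abs_zigzag_step[of "2 * int p" k r] assms by (simp add: double_zigzag_def Let_def)
  show "Suc r = 2 * p \<Longrightarrow> \<bar>double_zigzag p j c k c' (Suc r) - double_zigzag p j c k c' r\<bar> = \<bar>c'\<bar>"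
  proof -
    assume r: "Suc r = 2 * p"
    then have "r - p = p - 1" "\<not> r < p" "r < 2 * p" by auto
    then show ?thesis using r by (simp add: double_zigzag_def Let_def)
  qed
qed

section \<open>Reduction to arranging the odd differences\<close>

text \<open>The zigzags with indices below \<open>2 * w\<close> use up the even differences whatever
  the joining steps are. What is left is a partition of the odd numbers below
  \<open>4 * p * w = mn/2\<close> into joining steps and pairs \<open>q, q + 2\<close>, subject to
  the condition \<open>total\<close> on the displacement.\<close>

lemma hamiltonian_cycle_system_from_odd_differences:
  fixes p w :: nat and c c' :: "nat \<Rightarrow> int" and Q :: "int set"
  assumes "0 < p" "0 < w"
    and total: "\<And>i. i < w \<Longrightarrow>
        \<bar>double_zigzag p (2 * int i) (c i) (2 * int i + 1) (c' i) (2 * p)\<bar> = 2 * int p"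
    and c: "\<And>i. i < w \<Longrightarrow> odd (c i) \<and> \<bar>c i\<bar> < 4 * int p * int w"
    and c': "\<And>i. i < w \<Longrightarrow> odd (c' i) \<and> \<bar>c' i\<bar> < 4 * int p * int w"
    and Q: "\<And>q. q \<in> Q \<Longrightarrow> odd q \<and> 0 < q \<and> q + 2 < 4 * int p * int w"
    and inj: "\<And>i i'. i < w \<Longrightarrow> i' < w \<Longrightarrow> \<bar>c i\<bar> = \<bar>c i'\<bar> \<Longrightarrow> i = i'"
      "\<And>i i'. i < w \<Longrightarrow> i' < w \<Longrightarrow> \<bar>c' i\<bar> = \<bar>c' i'\<bar> \<Longrightarrow> i = i'"
    and disj: "\<And>i i'. i < w \<Longrightarrow> i' < w \<Longrightarrow> \<bar>c i\<bar> \<noteq> \<bar>c' i'\<bar>"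
      "\<And>i. i < w \<Longrightarrow> \<bar>c i\<bar> \<notin> Q" "\<And>i. i < w \<Longrightarrow> \<bar>c i\<bar> - 2 \<notin> Q"
      "\<And>i. i < w \<Longrightarrow> \<bar>c' i\<bar> \<notin> Q" "\<And>i. i < w \<Longrightarrow> \<bar>c' i\<bar> - 2 \<notin> Q"
      "\<And>q. q \<in> Q \<Longrightarrow> q + 2 \<notin> Q"
    and cover: "\<And>x. odd x \<Longrightarrow> 0 < x \<Longrightarrow> x < 4 * int p * int w \<Longrightarrow>
        (\<exists>i<w. x = \<bar>c i\<bar> \<or> x = \<bar>c' i\<bar>) \<or> x \<in> Q \<or> x - 2 \<in> Q"
    and mn: "m = 2 * int p" "n = 4 * int w"
  shows "\<exists>H. hamiltonian_cycle_system (multipartite_verts m n) (multipartite_edges m n) H \<and>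
             cyclic_system (m * n) H \<and> phi_symmetric m n H"
proof -
  define B where "B = Inl ` {..<w} \<union> Inr ` Q"
  define d where "d = case_sum (\<lambda>_::nat. 2 * p) (\<lambda>_::int. 2)"
  \<comment> \<open>The pair of \<open>q\<close> is realised by the walk \<open>0, q, -2\<close>,
    with steps \<open>q\<close> and \<open>-(q + 2)\<close>: it has total displacement -2, and it
    meets both residues modulo 2 because \<open>q\<close> is odd.\<close>
  define a where "a = case_sum (\<lambda>i. double_zigzag p (2 * int i) (c i) (2 * int i + 1) (c' i))
    (\<lambda>q r. if r = 0 then 0 else if r = 1 then q else - 2)"
  define f where "f = (\<lambda>(b, r). \<bar>a b (Suc r) - a b r\<bar>)"
  \<comment> \<open>\<open>K x y\<close>: the step at position \<open>y\<close> has absolute value \<open>x\<close>, with the kinds of steps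
    listed so that injectivity reduces to reading off \<open>y\<close> from \<open>x\<close>.\<close>
  define K where "K x y \<longleftrightarrow>
      (\<exists>j \<rho>. j < 2 * w \<and> Suc \<rho> < p \<and> x = 2 * (int \<rho> + 1) + m * int j \<and>
         y = (Inl (j div 2), (j mod 2) * p + \<rho>)) \<or>
      (\<exists>i<w. x = \<bar>c i\<bar> \<and> y = (Inl i, p - 1)) \<or> (\<exists>i<w. x = \<bar>c' i\<bar> \<and> y = (Inl i, 2 * p - 1)) \<or>
      (x \<in> Q \<and> y = (Inr x, 0)) \<or> (x - 2 \<in> Q \<and> y = (Inr (x - 2), 1))" for x :: int and y
  have "even m" by (simp add: mn)
  \<comment> \<open>Since \<open>2 * (\<rho> + 1) < 2 * p = m\<close>, division by \<open>m\<close>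
    recovers from an even difference both its zigzag and its place there.\<close>
  have dm: "(2 * (int \<rho> + 1) + m * int j) div m = int j"
      "(2 * (int \<rho> + 1) + m * int j) mod m = 2 * (int \<rho> + 1)" if "Suc \<rho> < p" for \<rho> j
    using that by (simp_all add: mn)
  have K_f: "K (f y) y" if y_in: "y \<in> Sigma B (\<lambda>b. {..<d b})" for y
  proof -
    obtain b r where y: "y = (b, r)" "b \<in> B" "r < d b" using y_in by auto
    show ?thesis
    proof (cases b)
      case (Inl i)
      then have i: "i < w" and r: "r < 2 * p" using y by (auto simp: B_def d_def)
      \<comment> \<open>Positions \<open>p - 1\<close> and \<open>2 * p - 1\<close> carry the
        joining steps; all others lie inside one of the two zigzags.\<close>
      consider "Suc r < p" | "Suc r = p" | \<rho> where "r = p + \<rho>" "Suc \<rho> < p" | "Suc r = 2 * p"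
      proof (cases "r < p")
        case False
        then show ?thesis using that(3)[of "r - p"] that(4) r by fastforce
      qed (use that in linarith)
      then show ?thesis
      proof cases
        case 1
        have "f y = 2 * (int r + 1) + m * int (2 * i)"
          using abs_double_zigzag_step(1)[OF _ _ 1] by (simp add: f_def y a_def Inl mn)
        then show ?thesis unfolding K_def using 1 i y Inl
          by (intro disjI1 exI[of _ "2 * i"] exI[of _ r]) auto
      next
        case 2
        then show ?thesis using abs_double_zigzag_step(2)[OF _ _ 2] i
          unfolding K_def by (simp add: f_def y a_def Inl) auto
      next
        case 3
        have "f y = 2 * (int \<rho> + 1) + m * int (2 * i + 1)"
          using abs_double_zigzag_step(3)[OF _ _ 3(2)] 3(1) by (simp add: f_def y a_def Inl mn)
        then show ?thesis unfolding K_def using 3 i y Inl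
          by (intro disjI1 exI[of _ "2 * i + 1"] exI[of _ \<rho>]) auto
      next
        case 4
        then show ?thesis using abs_double_zigzag_step(4)[OF _ _ 4] i
          unfolding K_def by (simp add: f_def y a_def Inl) auto
      qed
    next
      case (Inr q)
      then have "q \<in> Q" "r = 0 \<or> r = 1" using y by (auto simp: B_def d_def)
      then show ?thesis using Q[of q] by (auto simp: K_def f_def y a_def Inr)
    qed
  qed
  \<comment> \<open>Parity separates the zigzag steps from the joining steps and the pairs, so the
    two families can be treated independently.\<close>
  have K_even: "\<exists>j \<rho>. j < 2 * w \<and> Suc \<rho> < p \<and> x = 2 * (int \<rho> + 1) + m * int j \<and>
      y = (Inl (j div 2), (j mod 2) * p + \<rho>)" if "K x y" "even x" for x y
  proof -
    have "i < w \<Longrightarrow> x \<noteq> \<bar>c i\<bar>" "i < w \<Longrightarrow> x \<noteq> \<bar>c' i\<bar>" "x \<notin> Q" "x - 2 \<notin> Q" for i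
      using c[of i] c'[of i] Q[of x] Q[of "x - 2"] \<open>even x\<close> by auto
    then show ?thesis using that(1) unfolding K_def by blast
  qed
  have K_odd: "(\<exists>i<w. x = \<bar>c i\<bar> \<and> y = (Inl i, p - 1)) \<or> (\<exists>i<w. x = \<bar>c' i\<bar> \<and> y = (Inl i, 2 * p - 1)) \<or>
      (x \<in> Q \<and> y = (Inr x, 0)) \<or> (x - 2 \<in> Q \<and> y = (Inr (x - 2), 1))" if "K x y" "odd x" for x y
  proof -
    have "x \<noteq> 2 * (int \<rho> + 1) + m * int j" for \<rho> j using \<open>odd x\<close> \<open>even m\<close> by auto
    then show ?thesis using that(1) unfolding K_def by blast
  qed
  have K_unique: "y = z" if xy: "K x y" and xz: "K x z" for x y z
  proof (cases "even x")
    case True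
    obtain j \<rho> where 1: "Suc \<rho> < p" "x = 2 * (int \<rho> + 1) + m * int j"
        "y = (Inl (j div 2), (j mod 2) * p + \<rho>)"
      using K_even[OF xy True] by blast
    obtain k \<sigma> where 2: "Suc \<sigma> < p" "x = 2 * (int \<sigma> + 1) + m * int k"
        "z = (Inl (k div 2), (k mod 2) * p + \<sigma>)"
      using K_even[OF xz True] by blast
    have "x div m = int j" "x mod m = 2 * (int \<rho> + 1)"
      unfolding 1(2) by (rule dm[OF 1(1)])+
    moreover have "x div m = int k" "x mod m = 2 * (int \<sigma> + 1)"
      unfolding 2(2) by (rule dm[OF 2(1)])+
    ultimately show ?thesis using 1(3) 2(3) by simp
  next
    case False
    have Q2: "x \<notin> Q" if "x - 2 \<in> Q" using disj(6)[OF that] by simp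
    from K_odd[OF xy False] consider i where "i < w" "x = \<bar>c i\<bar>" "y = (Inl i, p - 1)"
      | i where "i < w" "x = \<bar>c' i\<bar>" "y = (Inl i, 2 * p - 1)"
      | "x \<in> Q" "y = (Inr x, 0)" | "x - 2 \<in> Q" "y = (Inr (x - 2), 1)" by blast
    then show ?thesis
    proof cases
      case (1 i)
      then have "x \<notin> Q" "x - 2 \<notin> Q" "\<And>i'. i' < w \<Longrightarrow> x \<noteq> \<bar>c' i'\<bar>" "\<And>i'. i' < w \<Longrightarrow> x = \<bar>c i'\<bar> \<Longrightarrow> i = i'"
        using disj(1)[OF 1(1)] disj(2,3)[OF 1(1)] inj(1)[OF 1(1)] by (metis, metis, metis, metis)
      then show ?thesis using K_odd[OF xz False] 1(3) by blast
    next
      case (2 i)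
      then have "x \<notin> Q" "x - 2 \<notin> Q" "\<And>i'. i' < w \<Longrightarrow> x \<noteq> \<bar>c i'\<bar>" "\<And>i'. i' < w \<Longrightarrow> x = \<bar>c' i'\<bar> \<Longrightarrow> i = i'"
        using disj(1)[OF _ 2(1)] disj(4,5)[OF 2(1)] inj(2)[OF 2(1)] by (metis, metis, metis, metis)
      then show ?thesis using K_odd[OF xz False] 2(3) by blast
    next
      case 3
      then have "x - 2 \<notin> Q" "\<And>i. i < w \<Longrightarrow> x \<noteq> \<bar>c i\<bar>" "\<And>i. i < w \<Longrightarrow> x \<noteq> \<bar>c' i\<bar>"
        using Q2 disj(2,4) by blast+
      then show ?thesis using K_odd[OF xz False] 3(2) by blast
    next
      case 4
      then have "x \<notin> Q" "\<And>i. i < w \<Longrightarrow> x \<noteq> \<bar>c i\<bar>" "\<And>i. i < w \<Longrightarrow> x \<noteq> \<bar>c' i\<bar>"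
        using Q2 disj(3,5) by blast+
      then show ?thesis using K_odd[OF xz False] 4(2) by blast
    qed
  qed
  have "inj_on f (Sigma B (\<lambda>b. {..<d b}))"
    by (rule inj_onI) (metis K_f K_unique)
  moreover have "f ` Sigma B (\<lambda>b. {..<d b}) = {x. 0 < x \<and> 2 * x < m * n \<and> \<not> m dvd x}" (is "?L = ?R")
  proof (intro equalityI subsetI)
    fix x assume "x \<in> ?L"
    then obtain y where "K x y" using K_f by blast
    show "x \<in> ?R"
    proof (cases "even x")
      case True
      then obtain j \<rho> where j: "j < 2 * w" "Suc \<rho> < p" "x = 2 * (int \<rho> + 1) + m * int j"
        using K_even[OF \<open>K x y\<close>] by blast
      have "0 \<le> m * int j" by (simp add: mn)
      then have "0 < x" using j(3) by simp
      have "m * (int j + 1) \<le> m * (2 * int w)"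
        using j(1) by (intro mult_left_mono) (auto simp: mn)
      moreover have "m * n = 2 * (m * (2 * int w))" by (simp add: mn)
      moreover have "x < m * (int j + 1)" using j(2,3) by (simp add: mn distrib_left)
      ultimately have "2 * x < m * n" by linarith
      moreover have "\<not> m dvd x" using dm(2)[OF j(2), of j] j(3) by (auto simp: dvd_eq_mod_eq_0)
      ultimately show ?thesis using \<open>0 < x\<close> by simp
    next
      case False
      from K_odd[OF \<open>K x y\<close> False] consider i where "i < w" "x = \<bar>c i\<bar>" | i where "i < w" "x = \<bar>c' i\<bar>"
        | "x \<in> Q" | "x - 2 \<in> Q" by blast
      then have "0 < x \<and> x < 4 * int p * int w"
      proof cases
        case (1 i)
        then show ?thesis using c[of i] False by auto
      next
        case (2 i)
        then show ?thesis using c'[of i] False by auto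
      qed (use Q[of x] Q[of "x - 2"] in auto)
      moreover have "\<not> m dvd x" using False \<open>even m\<close> dvd_trans by blast
      ultimately show ?thesis by (simp add: mn)
    qed
  next
    fix x assume "x \<in> ?R"
    then have x: "0 < x" "x < 4 * int p * int w" "\<not> m dvd x" by (auto simp: mn)
    show "x \<in> ?L"
    proof (cases "even x")
      case True
      \<comment> \<open>The inverse of the decomposition in \<open>dm\<close>: the remainder is even
        and nonzero, hence of the form \<open>2 * (\<rho> + 1)\<close>.\<close>
      define j where "j = nat (x div m)"
      define \<rho> where "\<rho> = nat ((x mod m) div 2 - 1)"
      have "0 < m" using \<open>0 < p\<close> by (simp add: mn)
      then have "0 \<le> x div m" using x by (simp add: pos_imp_zdiv_nonneg_iff)
      then have j: "int j = x div m" by (simp add: j_def)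
      have "x div m < 2 * int w"
        using x(2) by (simp add: int_div_less_iff[OF \<open>0 < m\<close>]) (simp add: mn)
      then have jw: "j < 2 * w" using j by linarith
      obtain t where t: "x mod m = 2 * t" using True \<open>even m\<close> by (meson dvd_mod evenE)
      have "x mod m \<noteq> 0" "0 \<le> x mod m" "x mod m < m"
        using x(3) \<open>0 < m\<close> by (simp_all add: dvd_eq_mod_eq_0)
      then have "0 < t" "t < int p" using t mn(1) by auto
      then have \<rho>: "2 * (int \<rho> + 1) = x mod m" "Suc \<rho> < p" by (auto simp: \<rho>_def t)
      have xeq: "x = 2 * (int \<rho> + 1) + m * int j" unfolding \<rho>(1) j by simp
      have mem: "(Inl (j div 2), (j mod 2) * p + \<rho>) \<in> Sigma B (\<lambda>b. {..<d b})"
        using jw \<rho>(2) by (cases "even j") (auto simp: B_def d_def odd_iff_mod_2_eq_one)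
      have "f (Inl (j div 2), (j mod 2) * p + \<rho>) = x"
      proof (cases "even j")
        case True
        then show ?thesis using abs_double_zigzag_step(1)[OF _ _ \<rho>(2)] xeq
          by (auto simp: f_def a_def mn elim!: evenE)
      next
        case False
        then show ?thesis using abs_double_zigzag_step(3)[OF _ _ \<rho>(2)] xeq
          by (auto simp: f_def a_def mn elim!: oddE)
      qed
      then show ?thesis using mem by force
    next
      case False
      from cover[OF False x(1,2)] consider i where "i < w" "x = \<bar>c i\<bar>" | i where "i < w" "x = \<bar>c' i\<bar>"
        | "x \<in> Q" | "x - 2 \<in> Q" by blast
      then show ?thesis
      proof cases
        case 1
        then show ?thesis using \<open>0 < p\<close>
          by (intro image_eqI[of _ _ "(Inl i, p - 1)"])
            (auto simp: f_def a_def B_def d_def abs_double_zigzag_step(2)[of _ _ "p - 1" p, simplified])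
      next
        case 2
        then show ?thesis using \<open>0 < p\<close>
          by (intro image_eqI[of _ _ "(Inl i, 2 * p - 1)"])
            (auto simp: f_def a_def B_def d_def abs_double_zigzag_step(4)[of _ _ "2 * p - 1" p, simplified])
      next
        case 3
        then show ?thesis using x(1)
          by (intro image_eqI[of _ _ "(Inr x, 0)"]) (auto simp: f_def a_def B_def d_def)
      next
        case 4
        then show ?thesis using x(1)
          by (intro image_eqI[of _ _ "(Inr (x - 2), 1)"]) (auto simp: f_def a_def B_def d_def)
      qed
    qed
  qed
  ultimately have bij: "bij_betw f (Sigma B (\<lambda>b. {..<d b})) {x. 0 < x \<and> 2 * x < m * n \<and> \<not> m dvd x}"
    by (simp add: bij_betw_def)
  show ?thesis
  proof (rule base_cycles_imp_hamiltonian_cycle_system[OF _ _ _ _ _ _ _ _ bij[unfolded f_def]])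
    show "0 < m" "0 < n" "even n" using assms by (simp_all add: mn)
    have "1 \<le> int p * int w" using assms by (simp add: Suc_le_eq flip: of_nat_mult)
    then show "3 \<le> m * n" by (simp add: mn)
  next
    fix b assume b: "b \<in> B"
    show "0 < d b" "int (d b) dvd m"
      using b \<open>0 < p\<close> by (auto simp: B_def d_def mn)
    show "inj_on (\<lambda>r. a b r mod int (d b)) {..<d b}"
    proof (cases b)
      case (Inl i)
      then show ?thesis using b c[of i] double_zigzag_inj_mod by (auto simp: a_def d_def B_def)
    next
      case (Inr q)
      then have "odd q" using b Q by (auto simp: B_def)
      then show ?thesis by (auto simp: Inr a_def d_def inj_on_def less_2_cases_iff odd_iff_mod_2_eq_one)
    qed
    show "gcd (a b (d b) - a b 0) (m * n) = int (d b)"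
    proof (cases b)
      case (Inl i)
      then have "\<bar>a b (d b)\<bar> = m" using b total[of i] by (auto simp: a_def d_def B_def mn)
      moreover have "a b 0 = 0" using \<open>0 < p\<close> by (simp add: a_def Inl double_zigzag_def zigzag_def)
      ultimately have "gcd (a b (d b) - a b 0) (m * n) = gcd m (m * n)" by (metis diff_zero gcd_abs1_int)
      then show ?thesis by (simp add: Inl d_def mn)
    next
      case (Inr q)
      then have "gcd (a b (d b) - a b 0) (m * n) = gcd 2 (m * n)" by (simp add: a_def d_def)
      also have "\<dots> = 2" using \<open>even m\<close> by (simp add: gcd_proj1_iff)
      finally show ?thesis by (simp add: Inr d_def)
    qed
  qed
qed

section \<open>Choice of the joining differences by the parity of \<open>p\<close>\<close>

theorem theorem4p4:
  fixes m n :: int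
  assumes "m \<ge> 2" and "even m" and "n > 0" and "n mod 4 = 0"
  shows "\<exists>H. hamiltonian_cycle_system (multipartite_verts m n) (multipartite_edges m n) H \<and>
             cyclic_system (m * n) H \<and> phi_symmetric m n H"
proof -
  define p where "p = nat (m div 2)"
  define w where "w = nat (n div 4)"
  have m: "m = 2 * int p" and n: "n = 4 * int w" and "0 < p" "0 < w"
    using assms by (auto simp: p_def w_def)
  have pw: "int w \<le> int p * int w" using \<open>0 < p\<close> by (simp flip: of_nat_mult)
  show ?thesis
  proof (cases "even p")
    case False
    \<comment> \<open>The joins \<open>4i + 1\<close> and \<open>4i + 3\<close> with
      \<open>i < w\<close> exhaust the odd numbers below \<open>4 * w\<close>; the odd numbers from
      there to \<open>4 * p * w\<close> are paired as \<open>4t + 1, 4t + 3\<close>.\<close>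
    define Q where "Q = {x. x mod 4 = 1 \<and> 4 * int w < x \<and> x < 4 * (int p * int w)}"
    show ?thesis
    proof (rule hamiltonian_cycle_system_from_odd_differences[OF \<open>0 < p\<close> \<open>0 < w\<close> _ _ _ _ _ _ _ _ _ _ _ _ _ m n,
          where c = "\<lambda>i. 4 * int i + 1" and c' = "\<lambda>i. - (4 * int i + 3)" and Q = Q])
      fix i
      \<comment> \<open>As \<open>p - 1\<close> is even, both zigzags end at
        \<open>-(p - 1)\<close>, and the total is
        \<open>-2(p - 1) + (4i + 1) - (4i + 3) = -2p\<close>.\<close>
      show "\<bar>double_zigzag p (2 * int i) (4 * int i + 1) (2 * int i + 1) (- (4 * int i + 3)) (2 * p)\<bar>
          = 2 * int p"
        using False \<open>0 < p\<close> by (simp add: double_zigzag_def zigzag_def Let_def)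
    next
      fix x :: int assume x: "odd x" "0 < x" "x < 4 * int p * int w"
      show "(\<exists>i<w. x = \<bar>4 * int i + 1\<bar> \<or> x = \<bar>- (4 * int i + 3)\<bar>) \<or> x \<in> Q \<or> x - 2 \<in> Q"
      proof (cases "x < 4 * int w")
        case True
        define i where "i = nat (x div 4)"
        have i: "int i = x div 4" using x(2) by (simp add: i_def)
        then have "i < w" using True by linarith
        moreover have "x = 4 * int i + 1 \<or> x = 4 * int i + 3" unfolding i using x(1) by presburger
        ultimately show ?thesis by (intro disjI1 exI[of _ i]) auto
      next
        case False
        define t where "t = x div 4"
        have "x = 4 * t + 1 \<or> x = 4 * t + 3" unfolding t_def using x(1) by presburger
        then have "x mod 4 = 1 \<and> 4 * int w < x \<or> (x - 2) mod 4 = 1 \<and> 4 * int w < x - 2"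
        proof
          assume x: "x = 4 * t + 3"
          then have "int w \<le> t" using False by linarith
          then show ?thesis using x by simp
        qed (use False in auto)
        then show ?thesis using x by (auto simp: Q_def mult.assoc)
      qed
    next
      fix i assume "i < w"
      then have "int i + 1 \<le> int p * int w" using pw by linarith
      then show "odd (4 * int i + 1) \<and> \<bar>4 * int i + 1\<bar> < 4 * int p * int w"
          "odd (- (4 * int i + 3)) \<and> \<bar>- (4 * int i + 3)\<bar> < 4 * int p * int w"
        by (simp_all add: mult.assoc)
      show "\<bar>4 * int i + 1\<bar> \<notin> Q" "\<bar>4 * int i + 1\<bar> - 2 \<notin> Q"
          "\<bar>- (4 * int i + 3)\<bar> \<notin> Q" "\<bar>- (4 * int i + 3)\<bar> - 2 \<notin> Q"
        using \<open>i < w\<close> by (simp_all add: Q_def)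
    next
      fix q assume q: "q \<in> Q"
      \<comment> \<open>The bound \<open>4 * p * w\<close> is a multiple of 4, so
        \<open>4t + 1\<close> below it forces \<open>4t + 3\<close> below it.\<close>
      define t where "t = q div 4"
      have t: "q = 4 * t + 1" using q div_mult_mod_eq[of q 4] by (simp add: Q_def t_def)
      then have "t < int p * int w" using q by (simp add: Q_def)
      then show "odd q \<and> 0 < q \<and> q + 2 < 4 * int p * int w"
        using q t by (simp add: Q_def mult.assoc)
      show "q + 2 \<notin> Q" by (simp add: Q_def t)
    next
      fix i i' :: nat
      show "\<bar>4 * int i + 1\<bar> \<noteq> \<bar>- (4 * int i' + 3)\<bar>" by simp presburger
    qed simp_all
  next
    case True
    then obtain v where v: "p = 2 * v" by blast
    \<comment> \<open>Here \<open>m = 4 * v\<close> and \<open>k = 2 * m\<close>. The range up to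
      \<open>mn/2 = k * w\<close> splits into \<open>w\<close> blocks of length \<open>k\<close>
      with the same pattern, block \<open>i\<close> containing both joins of index
      \<open>i\<close>.\<close>
    define k where "k = 8 * int v"
    have "k > 0" "even k" using v \<open>0 < p\<close> by (simp_all add: k_def)
    have kw: "4 * int p * int w = k * int w" by (simp add: k_def v)
    \<comment> \<open>Modulo \<open>k = 2m\<close> the joining differences are \<open>1\<close> and \<open>m - 1\<close>; \<open>G\<close> selects the smaller members
      of the pairs \<open>{3, 5}, \<dots>, {m - 5, m - 3}\<close> and \<open>{m + 1, m + 3}, \<dots>, {2m - 3, 2m - 1}\<close>.\<close>
    define G where "G \<rho> \<longleftrightarrow> \<rho> mod 4 = 3 \<and> \<rho> < 4 * int v - 3 \<or> \<rho> mod 4 = 1 \<and> 4 * int v < \<rho>" for \<rho> :: int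
    define Q where "Q = {x. 0 < x \<and> x < k * int w \<and> G (x mod k)}"
    have dm: "(k * i + \<rho>) div k = i" "(k * i + \<rho>) mod k = \<rho>" if "0 \<le> \<rho>" "\<rho> < k" for i \<rho>
      using that by simp_all
    have range: "0 \<le> k * int i + \<rho>" "k * int i + \<rho> < k * int w" if "i < w" "0 \<le> \<rho>" "\<rho> < k" for i \<rho>
    proof -
      show "0 \<le> k * int i + \<rho>" using \<open>0 < k\<close> that by simp
      have "k * (int i + 1) \<le> k * int w" using that(1) \<open>0 < k\<close> by simp
      then show "k * int i + \<rho> < k * int w" using that(3) by (simp add: distrib_left)
    qed
    have v1: "4 * int v \<ge> 4" "4 * int v < k" using v \<open>0 < p\<close> by (simp_all add: k_def)
    have abs_c: "\<bar>- (k * int i + 1)\<bar> = k * int i + 1"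
        "\<bar>- (k * int i + (4 * int v - 1))\<bar> = k * int i + (4 * int v - 1)" if "i < w" for i
      using range(1)[OF that, of 1] range(1)[OF that, of "4 * int v - 1"] v1 by linarith+
    have G_odd: "odd \<rho>" and G_next: "\<not> G (\<rho> + 2)" if "G \<rho>" for \<rho>
      using that unfolding G_def by presburger+
    \<comment> \<open>A selected residue above \<open>4 * v\<close> is 1 modulo 4, hence at most
      \<open>k - 3\<close>: no pair crosses a block boundary.\<close>
    have G_le: "\<rho> + 2 < k" if "G \<rho>" "\<rho> < k" for \<rho>
      using that v1(1) unfolding G_def k_def by presburger
    have Q_shift: "(q + 2) div k = q div k" "(q + 2) mod k = q mod k + 2" if "q \<in> Q" for q
    proof -
      have "q mod k < k" using \<open>k > 0\<close> by simp
      then have "q mod k + 2 < k" using that by (intro G_le) (simp_all add: Q_def)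
      moreover have "q + 2 = k * (q div k) + (q mod k + 2)" by simp
      ultimately show "(q + 2) div k = q div k" "(q + 2) mod k = q mod k + 2"
        using dm[of "q mod k + 2" "q div k"] \<open>k > 0\<close> by (metis add_nonneg_nonneg pos_mod_sign zero_le_numeral)+
    qed
    show ?thesis
    proof (rule hamiltonian_cycle_system_from_odd_differences[OF \<open>0 < p\<close> \<open>0 < w\<close> _ _ _ _ _ _ _ _ _ _ _ _ _ m n,
          where c = "\<lambda>i. - (k * int i + 1)" and c' = "\<lambda>i. - (k * int i + (4 * int v - 1))" and Q = Q,
          unfolded kw])
      fix i
      \<comment> \<open>Now \<open>p - 1\<close> is odd, so the zigzags contribute
        \<open>p + 2im\<close> and \<open>p + (2i + 1)m\<close>; subtracting the joins
        \<open>2im + 1\<close> and \<open>2im + m - 1\<close> leaves \<open>2p\<close>.\<close>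
      show "\<bar>double_zigzag p (2 * int i) (- (k * int i + 1)) (2 * int i + 1)
          (- (k * int i + (4 * int v - 1))) (2 * p)\<bar> = 2 * int p"
        using \<open>0 < p\<close> by (simp add: double_zigzag_def zigzag_def Let_def v k_def algebra_simps)
    next
      fix i assume i: "i < w"
      show "odd (- (k * int i + 1)) \<and> \<bar>- (k * int i + 1)\<bar> < k * int w"
        unfolding abs_c[OF i] using range(2)[OF i, of 1] v1 \<open>even k\<close> by simp
      show "odd (- (k * int i + (4 * int v - 1))) \<and> \<bar>- (k * int i + (4 * int v - 1))\<bar> < k * int w"
        unfolding abs_c[OF i] using range(2)[OF i, of "4 * int v - 1"] v1 \<open>even k\<close> by simp
    next
      fix q assume q: "q \<in> Q"
      show "odd q \<and> 0 < q \<and> q + 2 < k * int w"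
      proof (intro conjI)
        have "odd (q mod k)" using q by (intro G_odd) (simp add: Q_def)
        then show "odd q" by (simp add: k_def dvd_mod_iff)
        show "0 < q" using q by (simp add: Q_def)
        have "q div k < int w"
          using q by (simp add: Q_def int_div_less_iff[OF \<open>k > 0\<close>])
        then show "q + 2 < k * int w"
          by (simp only: Q_shift(1)[OF q] flip: int_div_less_iff[OF \<open>k > 0\<close>])
      qed
      show "q + 2 \<notin> Q"
        using q G_next by (simp add: Q_def Q_shift(2)[OF q])
    next
      fix i i' assume i: "i < w" "i' < w"
      note abs = abs_c[OF i(1)] abs_c[OF i(2)]
      show "i = i'" if "\<bar>- (k * int i + 1)\<bar> = \<bar>- (k * int i' + 1)\<bar>"
        using that \<open>k > 0\<close> unfolding abs by simp
      show "i = i'" if "\<bar>- (k * int i + (4 * int v - 1))\<bar> = \<bar>- (k * int i' + (4 * int v - 1))\<bar>"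
        using that \<open>k > 0\<close> unfolding abs by simp
      show "\<bar>- (k * int i + 1)\<bar> \<noteq> \<bar>- (k * int i' + (4 * int v - 1))\<bar>"
        unfolding abs using dm(2)[of 1 "int i"] dm(2)[of "4 * int v - 1" "int i'"] v1
        by (smt (verit))
    next
      fix i assume i: "i < w"
      have 1: "(k * int i + 1) mod k = 1" and 2: "(k * int i + (4 * int v - 1)) mod k = 4 * int v - 1"
        using dm(2) v1 by simp_all
      show "\<bar>- (k * int i + 1)\<bar> \<notin> Q" "\<bar>- (k * int i + (4 * int v - 1))\<bar> \<notin> Q"
        unfolding abs_c[OF i] Q_def mem_Collect_eq 1 2 using v1 by (simp_all add: G_def)
      show "\<bar>- (k * int i + 1)\<bar> - 2 \<notin> Q"
      proof
        assume "\<bar>- (k * int i + 1)\<bar> - 2 \<in> Q"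
        \<comment> \<open>Otherwise the remainder of \<open>k * i - 1\<close> would be
          \<open>1 - 2\<close>, which is negative.\<close>
        from Q_shift(2)[OF this] show False
          using 1 pos_mod_sign[OF \<open>k > 0\<close>, of "k * int i + 1 - 2"] unfolding abs_c[OF i] by simp
      qed
      show "\<bar>- (k * int i + (4 * int v - 1))\<bar> - 2 \<notin> Q"
      proof
        assume *: "\<bar>- (k * int i + (4 * int v - 1))\<bar> - 2 \<in> Q"
        have "(\<bar>- (k * int i + (4 * int v - 1))\<bar> - 2) mod k = 4 * int v - 3"
          using Q_shift(2)[OF *] 2 unfolding diff_add_cancel abs_c[OF i] by linarith
        \<comment> \<open>The residue \<open>4 * v - 3\<close> is 1 modulo 4 but not above
          \<open>4 * v\<close>, so \<open>G\<close> excludes it.\<close>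
        then have "G (4 * int v - 3)" using * unfolding Q_def by simp
        then show False by (simp add: G_def)
      qed
    next
      fix x :: int assume x: "odd x" "0 < x" "x < k * int w"
      define i where "i = nat (x div k)"
      define \<rho> where "\<rho> = x mod k"
      have "0 \<le> x div k" "x div k < int w"
        using x \<open>k > 0\<close> by (simp_all add: pos_imp_zdiv_nonneg_iff int_div_less_iff[OF \<open>k > 0\<close>])
      then have i: "i < w" "x = k * int i + \<rho>" by (simp_all add: i_def \<rho>_def)
      have \<rho>: "0 \<le> \<rho>" "\<rho> < k" "odd \<rho>" using \<open>k > 0\<close> x(1) by (simp_all add: \<rho>_def k_def dvd_mod_iff)
      \<comment> \<open>Below \<open>m = 4 * v\<close> the residues 3 modulo 4 other than
        \<open>m - 1\<close> are the smaller members of pairs and the residues 1 modulo 4 other than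
        1 the larger ones; above \<open>m\<close> the roles are exchanged.\<close>
      have "\<rho> = 1 \<or> \<rho> = 4 * int v - 1 \<or> G \<rho> \<or> 0 < \<rho> - 2 \<and> G (\<rho> - 2)"
      proof -
        define t where "t = \<rho> div 4"
        have "\<rho> = 4 * t + 1 \<or> \<rho> = 4 * t + 3" unfolding t_def using \<rho>(3) by presburger
        then show ?thesis 
        proof
          assume t: "\<rho> = 4 * t + 1"
          have "(4 * t - 1) mod 4 = 3" by presburger
          then show ?thesis using \<rho>(1) unfolding G_def t by (cases "t < int v") auto
        next
          assume t: "\<rho> = 4 * t + 3"
          consider "t + 1 < int v" | "t + 1 = int v" | "int v \<le> t" by linarith
          then show ?thesis using \<rho>(1) v1(1) unfolding G_def t by cases auto
        qed
      qed
      then consider "\<rho> = 1" | "\<rho> = 4 * int v - 1" | "G \<rho>" | "0 < \<rho> - 2" "G (\<rho> - 2)"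
        by blast
      then show "(\<exists>i<w. x = \<bar>- (k * int i + 1)\<bar> \<or> x = \<bar>- (k * int i + (4 * int v - 1))\<bar>) \<or> x \<in> Q \<or> x - 2 \<in> Q"
      proof cases
        case 1
        then show ?thesis using i abs_c(1)[OF i(1)] by metis
      next
        case 2
        then show ?thesis using i abs_c(2)[OF i(1)] by metis
      next
        case 3
        then have "x \<in> Q" using x unfolding Q_def \<rho>_def by blast
        then show ?thesis by blast
      next
        case 4
        have x2: "x - 2 = k * int i + (\<rho> - 2)" using i by simp
        have "(x - 2) mod k = \<rho> - 2" unfolding x2 using 4(1) \<rho>(2) by (intro dm(2)) auto
        moreover have "0 < x - 2"
          using i(2) 4(1) mult_nonneg_nonneg[of k "int i"] \<open>k > 0\<close> by linarith
        ultimately have "x - 2 \<in> Q" using x(3) 4(2) by (simp add: Q_def)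
        then show ?thesis by blast
      qed
    qed
  qed
qed

end
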